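(* Let $3\le\alpha\le\omega$ and let $(A_\beta)_{\beta<\alpha}$ be a partition of $\mathbb{N}$ into nonempty pairwise disjoint sets. Then the coloring associated to this partition is reconstructible.
   Context: A coloring on a set $X$ is a function $\varphi:[X]^2\to\{0,1\}$, where $[X]^2$ is the set of $2$-element subsets of $X$. The coloring associated to a partition $(A_\beta)_\beta$ of $X$ is given by $\varphi(\{x,y\})=1$ iff $x,y\in A_\beta$ for some $\beta$. $\mathrm{hom}(\varphi)=\{H\subseteq X:\ |H|>2 \text{ and } \varphi \text{ is constant on } [H]^2\}$. A coloring $\varphi$ on $X$ is reconstructible if for every coloring $\psi$ on $X$ with $\mathrm{hom}(\psi)=\mathrm{hom}(\varphi)$ one has $\psi=\varphi$ or $\psi=1-\varphi$. *)

theory Defs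
  imports "HOL-Library.Ramsey" "HOL-Library.Extended_Nat" "HOL-Library.Disjoint_Sets"
begin

text \<open>
  Colorings are extensional on the two-element subsets of \<open>X\<close> (undefined elsewhere), so that
  HOL equality of colorings is equality of functions on their domain.
\<close>

definition coloring :: "'a set \<Rightarrow> ('a set \<Rightarrow> nat) \<Rightarrow> bool" where
  "coloring X \<phi> \<longleftrightarrow> \<phi> \<in> [X]\<^bsup>2\<^esup> \<rightarrow>\<^sub>E {0, 1}"

definition complement_coloring :: "'a set \<Rightarrow> ('a set \<Rightarrow> nat) \<Rightarrow> ('a set \<Rightarrow> nat)" where
  "complement_coloring X \<phi> = (\<lambda>e\<in>[X]\<^bsup>2\<^esup>. 1 - \<phi> e)"

text \<open>Infinite homogeneous sets count as well; they need a separate disjunct because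
  \<open>card\<close> is \<open>0\<close> on infinite sets.\<close>

definition hom :: "'a set \<Rightarrow> ('a set \<Rightarrow> nat) \<Rightarrow> 'a set set" where
  "hom X \<phi> = {H. H \<subseteq> X \<and> (infinite H \<or> 2 < card H) \<and> (\<exists>c. \<forall>e\<in>[H]\<^bsup>2\<^esup>. \<phi> e = c)}"

definition reconstructible :: "'a set \<Rightarrow> ('a set \<Rightarrow> nat) \<Rightarrow> bool" where
  "reconstructible X \<phi> \<longleftrightarrow>
     coloring X \<phi> \<and>
     (\<forall>\<psi>. coloring X \<psi> \<and> hom X \<psi> = hom X \<phi> \<longrightarrow> \<psi> = \<phi> \<or> \<psi> = complement_coloring X \<phi>)"

text \<open>The ordinals up to \<open>\<omega>\<close> are represented by \<open>enat\<close>, with \<open>\<infinity>\<close> as \<open>\<omega>\<close>;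
  the indices below \<open>\<alpha>\<close> are then \<open>{\<beta>. enat \<beta> < \<alpha>}\<close>.\<close>

definition indexed_partition :: "'a set \<Rightarrow> 'i set \<Rightarrow> ('i \<Rightarrow> 'a set) \<Rightarrow> bool" where
  "indexed_partition X I A \<longleftrightarrow>
     (\<Union>\<beta>\<in>I. A \<beta>) = X \<and> (\<forall>\<beta>\<in>I. A \<beta> \<noteq> {}) \<and> disjoint_family_on A I"

definition partition_coloring :: "'a set \<Rightarrow> 'i set \<Rightarrow> ('i \<Rightarrow> 'a set) \<Rightarrow> ('a set \<Rightarrow> nat)" where
  "partition_coloring X I A = (\<lambda>e\<in>[X]\<^bsup>2\<^esup>. if \<exists>\<beta>\<in>I. e \<subseteq> A \<beta> then 1 else 0)"

end

theory Submission
  imports Defs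
begin

text \<open>Only homogeneous triples matter. Three points in distinct classes form a homogeneous triple,
  so with at least three classes any two edges between different classes are linked by a chain of
  such triples, and \<open>\<psi>\<close> is constant, say \<open>c\<close>, on these edges. An edge inside a class together with
  a point of another class forms a non-homogeneous triple, so \<open>\<psi>\<close> takes the other value on it.\<close>

text \<open>A three-point set passes the size condition in \<open>hom\<close> and has just three
  edges. Equality of two \<open>hom\<close> families is exploited only through this equivalence, so
  larger homogeneous sets are never inspected.\<close>

lemma triple_in_hom_iff:
  assumes "x \<in> X" "y \<in> X" "z \<in> X" "x \<noteq> y" "x \<noteq> z" "y \<noteq> z"
  shows "{x, y, z} \<in> hom X \<phi> \<longleftrightarrow> \<phi> {x, y} = \<phi> {x, z} \<and> \<phi> {x, y} = \<phi> {y, z}"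
proof -
  have "[{x, y, z}]\<^bsup>2\<^esup> = {{x, y}, {x, z}, {y, z}}"
  proof
    show "[{x, y, z}]\<^bsup>2\<^esup> \<subseteq> {{x, y}, {x, z}, {y, z}}"
      by (auto elim!: nsets2_E)
    show "{{x, y}, {x, z}, {y, z}} \<subseteq> [{x, y, z}]\<^bsup>2\<^esup>"
      using assms by simp
  qed
  then show ?thesis
    using assms by (auto simp: hom_def)
qed

lemma coloring_doubleton:
  assumes "coloring X \<phi>" "x \<in> X" "y \<in> X" "x \<noteq> y"
  shows "\<phi> {x, y} = 0 \<or> \<phi> {x, y} = 1"
proof -
  have "{x, y} \<in> [X]\<^bsup>2\<^esup>"
    using assms by simp
  then show ?thesis
    using assms(1) by (auto simp: coloring_def PiE_iff)
qed

lemma coloring_partition_coloring: "coloring X (partition_coloring X I A)"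
  by (auto simp: coloring_def partition_coloring_def)

lemma coloring_eqI:
  assumes "coloring X \<phi>" "coloring X \<psi>"
    and "\<And>x y. x \<in> X \<Longrightarrow> y \<in> X \<Longrightarrow> x \<noteq> y \<Longrightarrow> \<phi> {x, y} = \<psi> {x, y}"
  shows "\<phi> = \<psi>"
proof (rule PiE_ext)
  show "\<phi> \<in> [X]\<^bsup>2\<^esup> \<rightarrow>\<^sub>E {0, 1}" "\<psi> \<in> [X]\<^bsup>2\<^esup> \<rightarrow>\<^sub>E {0, 1}"
    using assms by (simp_all add: coloring_def)
  show "\<phi> e = \<psi> e" if "e \<in> [X]\<^bsup>2\<^esup>" for e
    using that assms(3) by (auto elim!: nsets2_E)
qed

lemma coloring_complement: "coloring X (complement_coloring X \<phi>)" if "coloring X \<phi>"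
  using that by (force simp: coloring_def complement_coloring_def PiE_iff)

text \<open>Stating the result for any index set with three distinct members treats finite \<alpha>
  and \<omega> at once.\<close>

theorem reconstructible_partition_coloring:
  assumes part: "indexed_partition X I A"
    and ijk: "i \<in> I" "j \<in> I" "k \<in> I" "i \<noteq> j" "i \<noteq> k" "j \<noteq> k"
  shows "reconstructible X (partition_coloring X I A)"
proof -
  \<comment> \<open>The index of the class of \<open>x\<close>. Disjointness makes it unique and
    covering makes it exist, so the description is meaningful for points of
    \<open>X\<close>.\<close>
  define cl where "cl x = (THE \<beta>. \<beta> \<in> I \<and> x \<in> A \<beta>)" for x
  have uniq: "\<beta> = \<gamma>" if "\<beta> \<in> I" "\<gamma> \<in> I" "x \<in> A \<beta>" "x \<in> A \<gamma>" for x \<beta> \<gamma>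
    using part that by (auto simp: indexed_partition_def disjoint_family_on_def)
  have cl_eq: "cl x = \<beta>" if "\<beta> \<in> I" "x \<in> A \<beta>" for x \<beta>
    unfolding cl_def by (rule the_equality) (use that uniq in auto)
  have cl_mem: "cl x \<in> I" "x \<in> A (cl x)" if x: "x \<in> X" for x
  proof -
    obtain \<beta> where "\<beta> \<in> I" "x \<in> A \<beta>"
      using part x by (auto simp: indexed_partition_def)
    then show "cl x \<in> I" "x \<in> A (cl x)"
      using cl_eq by auto
  qed
  define \<phi> where "\<phi> = partition_coloring X I A"
  have \<phi>: "\<phi> {x, y} = (if cl x = cl y then 1 else 0)" if xy: "x \<in> X" "y \<in> X" "x \<noteq> y" for x y
  proof -
    have "(\<exists>\<beta>\<in>I. {x, y} \<subseteq> A \<beta>) \<longleftrightarrow> cl x = cl y"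
    proof
      show "cl x = cl y" if "\<exists>\<beta>\<in>I. {x, y} \<subseteq> A \<beta>"
        using that by (auto simp: cl_eq)
      show "\<exists>\<beta>\<in>I. {x, y} \<subseteq> A \<beta>" if "cl x = cl y"
        using that cl_mem(1)[OF xy(1)] cl_mem(2)[OF xy(1)] cl_mem(2)[OF xy(2)]
        by (intro bexI[of _ "cl x"]) simp_all
    qed
    then show ?thesis
      using xy by (simp add: \<phi>_def partition_coloring_def)
  qed
  \<comment> \<open>Two values cannot exhaust \<open>i\<close>, \<open>j\<close>, \<open>k\<close>,
    and classes are nonempty. The values may coincide, so this also yields a point outside a single
    class.\<close>
  have third: "\<exists>w\<in>X. cl w \<noteq> \<beta> \<and> cl w \<noteq> \<gamma>" for \<beta> \<gamma>
  proof -
    obtain l where l: "l \<in> I" "l \<noteq> \<beta>" "l \<noteq> \<gamma>"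
      using ijk by metis
    then obtain w where w: "w \<in> A l"
      using part by (auto simp: indexed_partition_def)
    then have "w \<in> X"
      using part l by (auto simp: indexed_partition_def)
    then show ?thesis
      using l w cl_eq by blast
  qed
  have "\<psi> = \<phi> \<or> \<psi> = complement_coloring X \<phi>"
    if \<psi>: "coloring X \<psi>" and hom: "hom X \<psi> = hom X \<phi>" for \<psi>
  proof -
    have triple: "\<psi> {x, y} = \<psi> {x, z} \<and> \<psi> {x, y} = \<psi> {y, z} \<longleftrightarrow>
        \<phi> {x, y} = \<phi> {x, z} \<and> \<phi> {x, y} = \<phi> {y, z}"
      if "x \<in> X" "y \<in> X" "z \<in> X" "x \<noteq> y" "x \<noteq> z" "y \<noteq> z" for x y z
      using triple_in_hom_iff[OF that, of \<phi>] triple_in_hom_iff[OF that, of \<psi>] hom by simp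
    \<comment> \<open>All three edges of this triple have \<open>\<phi>\<close>-value 0, so it is
      homogeneous for \<open>\<phi>\<close> and hence for \<open>\<psi>\<close>.\<close>
    have cross3: "\<psi> {x, y} = \<psi> {x, z}"
      if "x \<in> X" "y \<in> X" "z \<in> X" "cl x \<noteq> cl y" "cl x \<noteq> cl z" "cl y \<noteq> cl z" for x y z
    proof -
      have "x \<noteq> y" "x \<noteq> z" "y \<noteq> z"
        using that by auto
      then show ?thesis
        using triple[of x y z] \<phi> that by simp
    qed
    have adjacent: "\<psi> {x, y} = \<psi> {x, z}"
      if "x \<in> X" "y \<in> X" "z \<in> X" "cl x \<noteq> cl y" "cl x \<noteq> cl z" for x y z
    proof (cases "cl y = cl z")
      case True
      \<comment> \<open>Here \<open>{x, y, z}\<close> is not homogeneous, so the comparison goes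
        through \<open>{x, w}\<close> with \<open>w\<close> in a third class.\<close>
      obtain w where "w \<in> X" "cl w \<noteq> cl x" "cl w \<noteq> cl y"
        using third by blast
      then show ?thesis
        using cross3[of x y w] cross3[of x z w] that True by simp
    qed (use cross3 that in blast)
    \<comment> \<open>Endpoints are exchanged one at a time. The intermediate edge must join
      different classes: \<open>{x, v}\<close> when \<open>x\<close> and \<open>u\<close> share a
      class, \<open>{x, u}\<close> otherwise.\<close>
    have cross: "\<psi> {x, y} = \<psi> {u, v}"
      if "x \<in> X" "y \<in> X" "u \<in> X" "v \<in> X" "cl x \<noteq> cl y" "cl u \<noteq> cl v" for x y u v
    proof (cases "cl x = cl u")
      case True
      then show ?thesis
        using adjacent[of x y v] adjacent[of v x u] that by (simp add: insert_commute)
    next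
      case False
      then show ?thesis
        using adjacent[of x y u] adjacent[of u x v] that by (simp add: insert_commute)
    qed
    obtain a where a: "a \<in> X"
      using third by blast
    obtain b where b: "b \<in> X" "cl b \<noteq> cl a"
      using third by blast
    define c where "c = \<psi> {a, b}"
    have c01: "c = 0 \<or> c = 1"
      unfolding c_def using coloring_doubleton[OF \<psi>] a b by blast
    have \<psi>_cross: "\<psi> {x, y} = c" if "x \<in> X" "y \<in> X" "cl x \<noteq> cl y" for x y
      unfolding c_def using cross[of x y a b] that a b by simp
    have \<psi>_inside: "\<psi> {x, y} = 1 - c" if xy: "x \<in> X" "y \<in> X" "x \<noteq> y" "cl x = cl y" for x y
    proof -
      obtain z where z: "z \<in> X" "cl z \<noteq> cl x"
        using third by blast
      then have ne: "x \<noteq> z" "y \<noteq> z"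
        using xy by auto
      have "\<psi> {x, z} = c" "\<psi> {y, z} = c"
        using \<psi>_cross[of x z] \<psi>_cross[of y z] xy z by auto
      moreover have "\<phi> {x, y} \<noteq> \<phi> {x, z}"
        using \<phi> xy z ne by simp
      \<comment> \<open>If \<open>\<psi> {x, y}\<close> were \<open>c\<close>, the triple would be
        homogeneous for \<open>\<psi>\<close> but not for \<open>\<phi>\<close>.\<close>
      ultimately have "\<psi> {x, y} \<noteq> c"
        using triple[of x y z] xy z ne by auto
      then show ?thesis
        using coloring_doubleton[OF \<psi> xy(1-3)] c01 by auto
    qed
    have \<phi>_col: "coloring X \<phi>"
      unfolding \<phi>_def by (rule coloring_partition_coloring)
    \<comment> \<open>Since \<open>\<phi>\<close> is 0 between classes, \<open>c = 0\<close> gives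
      \<open>\<phi>\<close> itself and \<open>c = 1\<close> its complement.\<close>
    from c01 show ?thesis
    proof
      assume "c = 0"
      then have "\<psi> = \<phi>"
        using \<psi>_cross \<psi>_inside \<phi> by (intro coloring_eqI[OF \<psi> \<phi>_col]) simp
      then show ?thesis ..
    next
      assume "c = 1"
      then have "\<psi> = complement_coloring X \<phi>"
        using \<psi>_cross \<psi>_inside \<phi>
        by (intro coloring_eqI[OF \<psi> coloring_complement[OF \<phi>_col]])
          (simp add: complement_coloring_def)
      then show ?thesis ..
    qed
  qed
  then show ?thesis
    using coloring_partition_coloring unfolding reconstructible_def \<phi>_def by blast
qed

theorem mainTheorem7:
  fixes \<alpha> :: enat and A :: "nat \<Rightarrow> nat set"
  assumes "3 \<le> \<alpha>" and "\<alpha> \<le> \<infinity>"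
    and "indexed_partition (UNIV :: nat set) {\<beta>. enat \<beta> < \<alpha>} A"
  shows "reconstructible (UNIV :: nat set)
           (partition_coloring (UNIV :: nat set) {\<beta>. enat \<beta> < \<alpha>} A)"
proof -
  \<comment> \<open>The bound 3 \<le> \<alpha> supplies the three distinct indices 0, 1, 2.\<close>
  have "enat n < \<alpha>" if "n < 3" for n
    using assms(1) that by (cases \<alpha>) (auto simp: numeral_eq_enat)
  then show ?thesis
    using reconstructible_partition_coloring[OF assms(3), of 0 1 2] by simp
qed

end
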